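(* Let $n>m$ be two positive integers, let $k\geqslant 0$ be an integer, and let $\mathbb{Z}^n\curvearrowright(X,\mu)$ and $\mathbb{Z}^m\curvearrowright(Y,\nu)$ be two free p.m.p. actions. Suppose that $\Phi:X\to Y$ is an orbit equivalence between these actions. Then $\Phi$ is not $\varpi^{(k)}_{m/n}$-integrable. Namely, $\mathbb{Z}^n$ cannot be $\left(\varpi^{(k)}_{m/n},L^0\right)$-orbit equivalent to $\mathbb{Z}^m$ when $n>m$.
   Context: **Functions.** $\log^{(1)}(t)=\log t$, $\log^{(j+1)}(t)=\log(\log^{(j)}(t))$ for $t$ sufficiently large, $\Lambda_k(t)=\prod_{j=1}^k\log^{(j)}(t)$ for $k\geqslant 1$, and $\Lambda_0(t)=1$. For real $\alpha>0$ and an integer $k\geqslant 0$, fix $T=T_{\alpha,k}>0$ such that $t\mapsto t^\alpha/\Lambda_k(t)$ is defined with all $\log^{(j)}(t)>0$ ($1\leqslant j\leqslant k$), continuous, positive and increasing on $[T,+\infty)$ (such $T$ exists). Define $\varpi^{(k)}_\alpha:\mathbb{R}_{\geqslant 0}\to\mathbb{R}$ by $\varpi^{(k)}_\alpha(t)=t^\alpha/\Lambda_k(t)$ for $t\geqslant T$ and $\varpi^{(k)}_\alpha(t)=T^\alpha/\Lambda_k(T)$ for $0\leqslant t<T$. **Orbit equivalence.** A p.m.p. action is a measurable, measure-preserving action of a countable group on a standard probability space; it is (essentially) free if for a.e. $x$ one has $gx\neq x$ for all $g\neq e$. An orbit equivalence from a p.m.p. action $G\curvearrowright(X,\mu)$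 to a p.m.p. action $H\curvearrowright(Y,\nu)$ is a measure isomorphism $\Phi:X\to Y$ with $\Phi(Gx)=H\Phi(x)$ for $\mu$-a.e. $x\in X$. When both actions are free, its cocycle $\kappa^\Phi:G\times X\to H$ is determined (for a.e. $x$) by $\Phi(gx)=\kappa^\Phi(g,x)\Phi(x)$ for all $g\in G$. **Integrability.** Let $\omega:\mathbb{R}_{\geqslant 0}\to\mathbb{R}_{\geqslant 0}$ be non-decreasing, $G,H$ finitely generated, and $|\cdot|_H$ a word length on $H$ (for $H=\mathbb{Z}^m$: the sum of the absolute values of the coordinates). An orbit equivalence $\Phi$ between free p.m.p. actions of $G$ and $H$ is $\omega$-integrable if for every $g\in G$ there is $c_g>0$ with $\int_X\omega\left(|\kappa^\Phi(g,x)|_H/c_g\right)\,\mathrm{d}\mu(x)<\infty$; $L^0$-integrable means no restriction. $\Phi$ is $(\omega_1,\omega_2)$-integrable if $\Phi$ is $\omega_1$-integrable and $\Phi^{-1}$ is $\omega_2$-integrable. $G$ is $(\omega_1,\omega_2)$-orbit equivalent to $H$ if there is an $(\omega_1,\omega_2)$-integrable orbit equivalence from some free p.m.p. $G$-action to some free p.m.p. $H$-action. *)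

theory Defs
  imports "HOL-Probability.Probability"
begin

section \<open>The functions $\varpi^{(k)}_\alpha$\<close>

definition iter_log :: "nat \<Rightarrow> real \<Rightarrow> real" where
  "iter_log j t = (ln ^^ j) t"

definition Lambda_log :: "nat \<Rightarrow> real \<Rightarrow> real" where
  "Lambda_log k t = (\<Prod>j=1..k. iter_log j t)"

text \<open>Since \<open>ln\<close> is total in HOL, that the iterated logarithms are defined at \<open>t\<close> is ensured by
  positivity of \<open>t\<close> and of all \<open>iter_log j t\<close>. \<open>admissible_threshold \<alpha> k T\<close> says that \<open>T\<close> is a
  legitimate choice of the constant $T_{\alpha,k}$.\<close>

definition admissible_threshold :: "real \<Rightarrow> nat \<Rightarrow> real \<Rightarrow> bool" where
  "admissible_threshold \<alpha> k T \<longleftrightarrow>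
     T > 0 \<and>
     (\<forall>t\<ge>T. \<forall>j\<in>{1..k}. iter_log j t > 0) \<and>
     continuous_on {T..} (\<lambda>t. t powr \<alpha> / Lambda_log k t) \<and>
     (\<forall>t\<ge>T. t powr \<alpha> / Lambda_log k t > 0) \<and>
     mono_on {T..} (\<lambda>t. t powr \<alpha> / Lambda_log k t)"

definition varpi :: "real \<Rightarrow> nat \<Rightarrow> real \<Rightarrow> real \<Rightarrow> real" where
  "varpi \<alpha> k T t =
     (if t \<ge> T then t powr \<alpha> / Lambda_log k t else T powr \<alpha> / Lambda_log k T)"

section \<open>Free p.m.p. actions\<close>

text \<open>The measurable sets are the Borel sets of some Polish topology on the underlying set.\<close>

definition standard_prob_space :: "'x measure \<Rightarrow> bool" where
  "standard_prob_space M \<longleftrightarrow>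
     prob_space M \<and>
     (\<exists>T. topspace T = space M \<and> completely_metrizable_space T \<and> second_countable T \<and>
          sets M = sigma_sets (space M) {U. openin T U})"

text \<open>The acting group is a type of class \<open>group_add\<close>, written additively but not assumed
  commutative.\<close>

definition pmp_action :: "'x measure \<Rightarrow> ('g::group_add \<Rightarrow> 'x \<Rightarrow> 'x) \<Rightarrow> bool" where
  "pmp_action M a \<longleftrightarrow>
     countable (UNIV :: 'g set) \<and>
     standard_prob_space M \<and>
     (\<forall>x\<in>space M. a 0 x = x) \<and>
     (\<forall>g h. \<forall>x\<in>space M. a (g + h) x = a g (a h x)) \<and>
     (\<forall>g. a g \<in> measurable M M \<and> distr M M (a g) = M)"

definition free_pmp_action :: "'x measure \<Rightarrow> ('g::group_add \<Rightarrow> 'x \<Rightarrow> 'x) \<Rightarrow> bool" where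
  "free_pmp_action M a \<longleftrightarrow>
     pmp_action M a \<and> (AE x in M. \<forall>g. g \<noteq> 0 \<longrightarrow> a g x \<noteq> x)"

section \<open>Orbit equivalence\<close>

text \<open>A measure isomorphism is a bimeasurable measure-preserving bijection between conull
  measurable sets; the values of \<open>\<Phi>\<close> off the conull set are irrelevant.\<close>

definition measure_iso :: "'x measure \<Rightarrow> 'y measure \<Rightarrow> ('x \<Rightarrow> 'y) \<Rightarrow> bool" where
  "measure_iso M N \<Phi> \<longleftrightarrow>
     (\<exists>X\<in>sets M. \<exists>Y\<in>sets N.
        (AE x in M. x \<in> X) \<and> (AE y in N. y \<in> Y) \<and>
        bij_betw \<Phi> X Y \<and>
        \<Phi> \<in> measurable (restrict_space M X) (restrict_space N Y) \<and>
        the_inv_into X \<Phi> \<in> measurable (restrict_space N Y) (restrict_space M X) \<and>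
        distr (restrict_space M X) (restrict_space N Y) \<Phi> = restrict_space N Y)"

definition orbit_equivalence ::
  "'x measure \<Rightarrow> ('g::group_add \<Rightarrow> 'x \<Rightarrow> 'x) \<Rightarrow> 'y measure \<Rightarrow> ('h::group_add \<Rightarrow> 'y \<Rightarrow> 'y) \<Rightarrow>
     ('x \<Rightarrow> 'y) \<Rightarrow> bool" where
  "orbit_equivalence M a N b \<Phi> \<longleftrightarrow>
     measure_iso M N \<Phi> \<and>
     (AE x in M. \<Phi> ` range (\<lambda>g. a g x) = range (\<lambda>h. b h (\<Phi> x)))"

text \<open>For an orbit equivalence between free actions, the description determines the value for
  almost every \<open>x\<close>.\<close>

definition oe_cocycle ::
  "('g \<Rightarrow> 'x \<Rightarrow> 'x) \<Rightarrow> ('h \<Rightarrow> 'y \<Rightarrow> 'y) \<Rightarrow> ('x \<Rightarrow> 'y) \<Rightarrow> 'g \<Rightarrow> 'x \<Rightarrow> 'h" where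
  "oe_cocycle a b \<Phi> g x = (THE h. \<Phi> (a g x) = b h (\<Phi> x))"

section \<open>Quantitative orbit equivalence\<close>

text \<open>The constructor \<open>L0\<close> stands for no restriction. The parameters \<open>len\<close>, \<open>lenG\<close>, \<open>lenH\<close> below
  are the word lengths on the respective target groups.\<close>

datatype integrability = L0 | Weight "real \<Rightarrow> real"

fun integrable_oe ::
  "integrability \<Rightarrow> ('h \<Rightarrow> real) \<Rightarrow> 'x measure \<Rightarrow> ('g \<Rightarrow> 'x \<Rightarrow> 'x) \<Rightarrow> ('h \<Rightarrow> 'y \<Rightarrow> 'y) \<Rightarrow>
     ('x \<Rightarrow> 'y) \<Rightarrow> bool" where
  "integrable_oe L0 len M a b \<Phi> \<longleftrightarrow> True"
| "integrable_oe (Weight \<omega>) len M a b \<Phi> \<longleftrightarrow>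
     (\<forall>g. \<exists>c>0. (\<integral>\<^sup>+x. ennreal (\<omega> (len (oe_cocycle a b \<Phi> g x) / c)) \<partial>M) < \<infinity>)"

text \<open>\<open>\<Psi>\<close> represents the inverse of \<open>\<Phi>\<close>, which is only determined almost everywhere.\<close>

definition biintegrable_oe ::
  "integrability \<Rightarrow> integrability \<Rightarrow> ('g \<Rightarrow> real) \<Rightarrow> ('h \<Rightarrow> real) \<Rightarrow>
     'x measure \<Rightarrow> ('g \<Rightarrow> 'x \<Rightarrow> 'x) \<Rightarrow> 'y measure \<Rightarrow> ('h \<Rightarrow> 'y \<Rightarrow> 'y) \<Rightarrow>
     ('x \<Rightarrow> 'y) \<Rightarrow> bool" where
  "biintegrable_oe i j lenG lenH M a N b \<Phi> \<longleftrightarrow>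
     integrable_oe i lenH M a b \<Phi> \<and>
     (\<exists>\<Psi>. measure_iso N M \<Psi> \<and> (AE x in M. \<Psi> (\<Phi> x) = x) \<and> (AE y in N. \<Phi> (\<Psi> y) = y) \<and>
          integrable_oe j lenG N b a \<Psi>)"

text \<open>HOL cannot quantify existentially over types, so the types of points of the two probability
  spaces are parameters; the groups are the domains of the two length functions.\<close>

definition groups_orbit_equivalent ::
  "'x itself \<Rightarrow> 'y itself \<Rightarrow> integrability \<Rightarrow> integrability \<Rightarrow>
     ('g::group_add \<Rightarrow> real) \<Rightarrow> ('h::group_add \<Rightarrow> real) \<Rightarrow> bool" where
  "groups_orbit_equivalent _ _ i j lenG lenH \<longleftrightarrow>
     (\<exists>(M :: 'x measure) (a :: 'g \<Rightarrow> 'x \<Rightarrow> 'x) (N :: 'y measure) (b :: 'h \<Rightarrow> 'y \<Rightarrow> 'y) \<Phi>.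
        free_pmp_action M a \<and> free_pmp_action N b \<and>
        orbit_equivalence M a N b \<Phi> \<and>
        biintegrable_oe i j lenG lenH M a N b \<Phi>)"

definition l1_length :: "int ^ 'm \<Rightarrow> real" where
  "l1_length v = (\<Sum>i\<in>UNIV. real_of_int \<bar>v $ i\<bar>)"

end

theory Submission
  imports Defs
begin

text \<open>Let $\alpha = m/n$, so that $0 < \alpha < 1$, and let $\kappa$ be the cocycle of an orbit
  equivalence from an action of $\mathbb{Z}^n$ to an action of $\mathbb{Z}^m$. Since both actions are
  free, $\kappa(\cdot, x)$ is injective for almost every \<open>x\<close>.

  The geometric part bounds $\kappa$ from below. Let \<open>F\<close> be the cube of side \<open>L\<close> in
  $\mathbb{Z}^m$ and \<open>B\<close> the cube of side \<open>r\<close> in $\mathbb{Z}^n$, where \<open>r\<close> is of order $L^\alpha$ and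
  large enough for \<open>B\<close> to have at least twice as many points as \<open>F\<close>. By injectivity, for each
  \<open>f \<in> F\<close> at least half of the points $\kappa(b, x) + f$ with \<open>b \<in> B\<close> lie outside \<open>F\<close>. So, on average
  over \<open>b\<close>, the translation by $\kappa(b, x)$ displaces at least half of \<open>F\<close>. The number of displaced
  points is subadditive in the translation vector; by the cocycle identity and invariance of the
  measure, its mean over \<open>x\<close> is subadditive in \<open>b\<close>. Hence the unit vectors displace a proportion of
  at least $1/(2r)$ in total. A translation by \<open>v\<close> displaces a proportion of at most
  $\min(1, |v|/L)$, and therefore
  \[ \sum_i \int \min(1, |\kappa(e_i, x)|/L) \, d\mu(x) \ge \mathrm{const} \cdot L^{-\alpha} \]
  for every \<open>L \<ge> 1\<close> (\<open>cocycle_displacement_lower_bound\<close>). This takes the place of an isoperimetric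
  inequality in $\mathbb{Z}^n$ for the sets that correspond to translates of \<open>F\<close> inside the orbits.

  The analytic part shows that integrability of $\varpi = \varpi^{(k)}_\alpha$ along the cocycle is
  incompatible with this bound. On the one hand $\sum_j \varpi(2^j) \min(1, u/2^j)$ is at most a
  constant times $\varpi(u)$, where \<open>j\<close> runs over all sufficiently large integers, since $\varpi$
  grows geometrically along powers of 2, at a rate strictly between 1 and 2
  (\<open>varpi_dyadic_sum_le\<close>). On the other hand
  $\varpi(2^j) 2^{-\alpha j} = 1/\Lambda_k(2^j)$, and the sum of these numbers diverges like
  $\log^{(k+1)}$ (\<open>sum_inverse_Lambda_log_unbounded\<close>). So a single critical scale would not contradict
  integrability, but all scales together do.\<close>

section \<open>Displacement of finite sets by translations\<close>

definition displaced :: "'h::group_add set \<Rightarrow> 'h \<Rightarrow> nat" where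
  "displaced F v = card {f\<in>F. v + f \<notin> F}"

lemma displaced_zero [simp]: "displaced F 0 = 0"
  by (simp add: displaced_def)

lemma displaced_le_card: "finite F \<Longrightarrow> displaced F v \<le> card F"
  unfolding displaced_def by (rule card_mono) auto

text \<open>Moving \<open>f\<close> first by \<open>w\<close> and then by \<open>v\<close> can leave \<open>F\<close> in either of the two steps, and the
  points that survive the first step are mapped injectively into \<open>F\<close> by it.\<close>
lemma displaced_add:
  assumes "finite F"
  shows "displaced F (v + w) \<le> displaced F v + displaced F w"
proof -
  let ?E = "{f\<in>F. w + f \<in> F \<and> v + (w + f) \<notin> F}"
  have "displaced F (v + w) \<le> card (?E \<union> {f\<in>F. w + f \<notin> F})"
    unfolding displaced_def using assms by (intro card_mono) (auto simp: add.assoc)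
  also have "\<dots> \<le> card ?E + displaced F w"
    unfolding displaced_def by (rule card_Un_le)
  also have "card ?E \<le> displaced F v"
    unfolding displaced_def
  proof (rule card_inj_on_le)
    show "inj_on (\<lambda>f. w + f) ?E" by (auto simp: inj_on_def)
    show "(\<lambda>f. w + f) ` ?E \<subseteq> {f\<in>F. v + f \<notin> F}" by auto
  qed (use assms in auto)
  finally show ?thesis by simp
qed

text \<open>The displacement is forced by counting. For each \<open>f \<in> F\<close> the points \<open>\<kappa> b + f\<close> with \<open>b \<in> B\<close> are
  distinct, so at most \<open>card F\<close> of them lie in \<open>F\<close>, and the others count towards the displacement.\<close>
lemma sum_displaced_ge:
  fixes \<kappa> :: "'g \<Rightarrow> 'h::group_add"
  assumes F: "finite F" and B: "finite B" and inj: "inj_on \<kappa> B"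
  shows "card F * card B \<le> (\<Sum>b\<in>B. displaced F (\<kappa> b)) + card F * card F"
proof -
  have "card B \<le> card {b\<in>B. \<kappa> b + f \<notin> F} + card F" for f
  proof -
    have "card B = card ({b\<in>B. \<kappa> b + f \<notin> F} \<union> {b\<in>B. \<kappa> b + f \<in> F})"
      by (rule arg_cong[where f=card]) auto
    also have "\<dots> \<le> card {b\<in>B. \<kappa> b + f \<notin> F} + card {b\<in>B. \<kappa> b + f \<in> F}"
      by (rule card_Un_le)
    also have "card {b\<in>B. \<kappa> b + f \<in> F} \<le> card F"
      by (rule card_inj_on_le[where f="\<lambda>b. \<kappa> b + f"]) (use inj F in \<open>auto simp: inj_on_def\<close>)
    finally show ?thesis by simp
  qed
  then have "(\<Sum>f\<in>F. card B) \<le> (\<Sum>f\<in>F. card {b\<in>B. \<kappa> b + f \<notin> F} + card F)"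
    by (intro sum_mono)
  moreover have "(\<Sum>f\<in>F. card {b\<in>B. \<kappa> b + f \<notin> F}) = (\<Sum>b\<in>B. displaced F (\<kappa> b))"
    unfolding displaced_def using sum.swap[of "\<lambda>f b. of_bool (\<kappa> b + f \<notin> F) :: nat" B F] F B
    by (simp add: of_bool_def sum.If_cases Int_def conj_commute)
  ultimately show ?thesis by (simp add: sum.distrib)
qed

definition vec_box :: "('i \<Rightarrow> int set) \<Rightarrow> (int ^ 'i::finite) set" where
  "vec_box S = {v. \<forall>i. v $ i \<in> S i}"

lemma vec_box_bij: "bij_betw vec_lambda (PiE UNIV S) (vec_box S)"
  by (rule bij_betw_byWitness[where f'=vec_nth]) (auto simp: vec_box_def)

lemma card_vec_box: "card (vec_box S) = (\<Prod>i\<in>UNIV. card (S i))"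
  using bij_betw_same_card[OF vec_box_bij[of S]] by (simp add: card_PiE)

lemma finite_vec_box: "(\<And>i. finite (S i)) \<Longrightarrow> finite (vec_box S)"
  using bij_betw_finite[OF vec_box_bij[of S]] by (simp add: finite_PiE)

definition vec_cube :: "nat \<Rightarrow> (int ^ 'i::finite) set" where
  "vec_cube L = vec_box (\<lambda>_. {0..<int L})"

lemma card_vec_cube: "card (vec_cube L :: (int ^ 'i::finite) set) = L ^ CARD('i)"
  by (simp add: vec_cube_def card_vec_box)

lemma finite_vec_cube: "finite (vec_cube L)"
  by (simp add: vec_cube_def finite_vec_box)

text \<open>A point that leaves the cube leaves it through some coordinate \<open>j\<close>, and the points that do so
  form a box with at most \<open>\<bar>v $ j\<bar>\<close> possible values of the coordinate \<open>j\<close>.\<close>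
lemma displaced_cube_le:
  fixes v :: "int ^ 'i::finite"
  assumes L: "L > 0"
  shows "real (displaced (vec_cube L) v) \<le> real L ^ CARD('i) * min 1 (l1_length v / real L)"
proof -
  let ?S = "\<lambda>j. (\<lambda>_. {0..<int L})(j := {t\<in>{0..<int L}. v $ j + t \<notin> {0..<int L}})"
  have slab: "real (card (vec_box (?S j))) \<le> real L ^ CARD('i) / real L * real_of_int \<bar>v $ j\<bar>" for j
  proof -
    have "card {t\<in>{0..<int L}. v $ j + t \<notin> {0..<int L}} \<le> nat \<bar>v $ j\<bar>"
    proof -
      have "{t\<in>{0..<int L}. v $ j + t \<notin> {0..<int L}} \<subseteq>
              (if v $ j \<ge> 0 then {int L - v $ j..<int L} else {0..<- v $ j})"
        by auto
      then have "card {t\<in>{0..<int L}. v $ j + t \<notin> {0..<int L}} \<le>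
              card (if v $ j \<ge> 0 then {int L - v $ j..<int L} else {0..<- v $ j})"
        by (rule card_mono[rotated]) auto
      then show ?thesis by (auto split: if_splits)
    qed
    moreover have "(\<Prod>i\<in>UNIV - {j}. card (?S j i)) = L ^ (CARD('i) - 1)"
      by (subst prod.cong[OF refl, where h="\<lambda>_. L"]) auto
    moreover have "card (vec_box (?S j)) = card (?S j j) * (\<Prod>i\<in>UNIV - {j}. card (?S j i))"
      unfolding card_vec_box by (rule prod.remove) auto
    ultimately have "card (vec_box (?S j)) \<le> nat \<bar>v $ j\<bar> * L ^ (CARD('i) - 1)"
      by simp
    then have "real (card (vec_box (?S j))) \<le> real (nat \<bar>v $ j\<bar> * L ^ (CARD('i) - 1))"
      by (simp only: of_nat_le_iff)
    also have "\<dots> = real L ^ CARD('i) / real L * real_of_int \<bar>v $ j\<bar>"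
      using L by (cases "CARD('i)") auto
    finally show ?thesis .
  qed
  have "{f\<in>vec_cube L. v + f \<notin> vec_cube L} \<subseteq> (\<Union>j\<in>UNIV. vec_box (?S j))"
    by (auto simp: vec_cube_def vec_box_def) 
  then have "displaced (vec_cube L) v \<le> card (\<Union>j\<in>UNIV. vec_box (?S j))"
    unfolding displaced_def
    by (rule card_mono[rotated])
       (intro finite_UN_I finite finite_vec_box, rule finite_subset[of _ "{0..<int L}"], auto)
  also have "\<dots> \<le> (\<Sum>j\<in>UNIV. card (vec_box (?S j)))"
    by (rule card_UN_le) simp
  finally have "real (displaced (vec_cube L) v) \<le> real (\<Sum>j\<in>UNIV. card (vec_box (?S j)))"
    by (simp only: of_nat_le_iff)
  also have "\<dots> \<le> (\<Sum>j\<in>UNIV. real L ^ CARD('i) / real L * real_of_int \<bar>v $ j\<bar>)"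
    unfolding of_nat_sum by (intro sum_mono slab)
  also have "\<dots> = real L ^ CARD('i) * (l1_length v / real L)"
    by (simp add: l1_length_def sum_distrib_left sum_divide_distrib mult_ac)
  finally have "real (displaced (vec_cube L) v) \<le> real L ^ CARD('i) * (l1_length v / real L)" .
  moreover have "real (displaced (vec_cube L) v) \<le> real L ^ CARD('i)"
    using displaced_le_card[OF finite_vec_cube, of L v] card_vec_cube[of L, where ?'i='i]
    by (simp flip: of_nat_power)
  ultimately show ?thesis by (simp add: min_def)
qed

lemma subadditive_vec_le:
  fixes D :: "int ^ 'i::finite \<Rightarrow> real"
  assumes zero: "D 0 = 0" and add: "\<And>v w. D (v + w) \<le> D v + D w" and "\<And>i. v $ i \<ge> 0"
  shows "D v \<le> (\<Sum>i\<in>UNIV. real_of_int (v $ i) * D (axis i 1))"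
proof -
  have ax: "D (axis i (int t)) \<le> real t * D (axis i 1)" for i t
  proof (induction t)
    case (Suc t)
    have "axis i (int (Suc t)) = (axis i (int t) + axis i 1 :: int ^ 'i)"
      by (simp add: vec_eq_iff axis_def)
    then have "D (axis i (int (Suc t))) \<le> D (axis i (int t)) + D (axis i 1)"
      by (simp add: add)
    then show ?case using Suc by (simp add: algebra_simps)
  qed (simp add: zero axis_def flip: zero_vec_def)
  have "D (\<Sum>i\<in>I. axis i (v $ i)) \<le> (\<Sum>i\<in>I. D (axis i (v $ i)))" if "finite I" for I
    using that
  proof induction
    case (insert j I)
    then show ?case using add[of "axis j (v $ j)" "\<Sum>i\<in>I. axis i (v $ i)"] by simp
  qed (simp add: zero)
  moreover have "(\<Sum>i\<in>UNIV. axis i (v $ i)) = v"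
    by (simp add: vec_eq_iff axis_def)
  ultimately have "D v \<le> (\<Sum>i\<in>UNIV. D (axis i (v $ i)))"
    by (metis finite)
  also have "\<dots> \<le> (\<Sum>i\<in>UNIV. real_of_int (v $ i) * D (axis i 1))"
  proof (rule sum_mono)
    fix i
    show "D (axis i (v $ i)) \<le> real_of_int (v $ i) * D (axis i 1)"
      using ax[of i "nat (v $ i)"] assms(3)[of i] by simp
  qed
  finally show ?thesis .
qed

section \<open>Mean displacement of an injective cocycle\<close>

text \<open>The cocycle of an orbit equivalence between free actions, reduced to the properties that the
  estimate uses. Injectivity reflects that the source action is free; freeness of the target action
  makes the cocycle well defined and yields its identity.\<close>
locale free_cocycle = prob_space M
  for M :: "'x measure" and a :: "'g::group_add \<Rightarrow> 'x \<Rightarrow> 'x"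
    and K :: "'g \<Rightarrow> 'x \<Rightarrow> 'h::group_add" +
  assumes measurable_a [measurable]: "a g \<in> measurable M M"
    and preserving: "distr M M (a g) = M"
    and measurable_K [measurable]: "K g \<in> measurable M (count_space UNIV)"
    and cocycle: "AE x in M. K (g + h) x = K g (a h x) + K h x"
    and injective: "AE x in M. inj (\<lambda>g. K g x)"
begin

definition mean_displacement :: "'h set \<Rightarrow> 'g \<Rightarrow> real" where
  "mean_displacement F g = (\<integral>x. real (displaced F (K g x)) \<partial>M)"

lemma borel_measurable_K [measurable]: "(\<lambda>x. f (K g x) :: real) \<in> borel_measurable M"
  by (rule measurable_compose[OF measurable_K]) simp

context
  fixes F :: "'h set"
  assumes F: "finite F"
begin

lemma integrable_displaced: "integrable M (\<lambda>x. real (displaced F (K g x)))"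
  by (rule integrable_const_bound[where B="real (card F)"])
     (use displaced_le_card[OF F] in auto)

lemma mean_displacement_translate:
  "(\<integral>x. real (displaced F (K g (a h x))) \<partial>M) = mean_displacement F g"
proof -
  have "mean_displacement F g = (\<integral>x. real (displaced F (K g x)) \<partial>distr M M (a h))"
    by (simp add: mean_displacement_def preserving)
  also have "\<dots> = (\<integral>x. real (displaced F (K g (a h x))) \<partial>M)"
    by (rule integral_distr) (rule measurable_a, rule borel_measurable_K)
  finally show ?thesis ..
qed

text \<open>The cocycle identity for \<open>0 + 0\<close> forces \<open>K 0\<close> to vanish, up to a translation by \<open>a 0\<close>, which
  preserves the mean.\<close>
lemma mean_displacement_zero: "mean_displacement F 0 = 0"
proof -
  have "AE x in M. K 0 (a 0 x) = 0"
    using cocycle[of 0 0] by (rule AE_mp, intro AE_I2 impI) (metis add_0 add_right_cancel)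
  then have "(\<integral>x. real (displaced F (K 0 (a 0 x))) \<partial>M) = 0"
    by (intro integral_eq_zero_AE) auto
  then show ?thesis by (simp add: mean_displacement_translate)
qed

text \<open>The cocycle identity turns the subadditivity of the displacement into subadditivity in the
  source group, because the action preserves the measure and so the base point \<open>a h x\<close> can be
  replaced by \<open>x\<close> in the mean.\<close>
lemma mean_displacement_add:
  "mean_displacement F (g + h) \<le> mean_displacement F g + mean_displacement F h"
proof -
  have "(\<lambda>x. real (displaced F (K g (a h x)))) \<in> borel_measurable M"
    by (rule measurable_compose[OF measurable_a borel_measurable_K])
  then have int: "integrable M (\<lambda>x. real (displaced F (K g (a h x))))"
    by (intro integrable_const_bound[where B="real (card F)"])
       (use displaced_le_card[OF F] in auto)
  have "mean_displacement F (g + h) \<le>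
      (\<integral>x. real (displaced F (K g (a h x))) + real (displaced F (K h x)) \<partial>M)"
    unfolding mean_displacement_def
  proof (rule integral_mono_AE)
    show "AE x in M. real (displaced F (K (g + h) x))
        \<le> real (displaced F (K g (a h x))) + real (displaced F (K h x))"
      using cocycle[of g h]
    proof (rule AE_mp, intro AE_I2 impI)
      fix x assume "K (g + h) x = K g (a h x) + K h x"
      then show "real (displaced F (K (g + h) x))
        \<le> real (displaced F (K g (a h x))) + real (displaced F (K h x))"
        using displaced_add[OF F] by (simp flip: of_nat_add)
    qed
  qed (intro integrable_displaced Bochner_Integration.integrable_add int)+
  also have "\<dots> = mean_displacement F g + mean_displacement F h"
    by (subst Bochner_Integration.integral_add)
       (auto intro!: int integrable_displaced simp: mean_displacement_translate mean_displacement_def)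
  finally show ?thesis .
qed

lemma sum_mean_displacement_ge:
  assumes B: "finite B"
  shows "real (card F) * real (card B) - real (card F) * real (card F) \<le> (\<Sum>b\<in>B. mean_displacement F b)"
proof -
  have "real (card F) * real (card B) - real (card F) * real (card F) =
      (\<integral>x. real (card F) * real (card B) - real (card F) * real (card F) \<partial>M)"
    by (simp add: prob_space)
  also have "\<dots> \<le> (\<integral>x. (\<Sum>b\<in>B. real (displaced F (K b x))) \<partial>M)"
  proof (rule integral_mono_AE)
    show "AE x in M. real (card F) * real (card B) - real (card F) * real (card F)
        \<le> (\<Sum>b\<in>B. real (displaced F (K b x)))"
      using injective
    proof (rule AE_mp, intro AE_I2 impI)
      fix x assume "inj (\<lambda>g. K g x)"
      then have "inj_on (\<lambda>g. K g x) B" by (rule inj_on_subset) simp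
      from sum_displaced_ge[OF F B this] 
      have "real (card F * card B) \<le> real ((\<Sum>b\<in>B. displaced F (K b x)) + card F * card F)"
        by (simp only: of_nat_le_iff)
      then show "real (card F) * real (card B) - real (card F) * real (card F)
        \<le> (\<Sum>b\<in>B. real (displaced F (K b x)))" by simp
    qed
  qed (auto intro!: integrable_displaced)
  also have "\<dots> = (\<Sum>b\<in>B. mean_displacement F b)"
    unfolding mean_displacement_def by (rule Bochner_Integration.integral_sum) (rule integrable_displaced)
  finally show ?thesis .
qed

end

end

text \<open>The cube of side \<open>r\<close> in the source has at least twice as many points as the cube of side \<open>L\<close>
  in the target, so on average over the source cube at least half of the target cube is displaced.
  A point of the source cube is a sum of at most \<open>r\<close> unit vectors in each direction, so by
  subadditivity the unit vectors already displace a proportion of order \<open>1 / r\<close>. With the smallest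
  possible \<open>r\<close> this proportion is of order $L^{-m/n}$.\<close>
lemma cocycle_displacement_lower_bound:
  fixes a :: "int ^ 'n::finite \<Rightarrow> 'x \<Rightarrow> 'x" and K :: "int ^ 'n \<Rightarrow> 'x \<Rightarrow> int ^ 'm::finite"
  assumes "free_cocycle M a K" and L: "L > 0" and r: "2 * L ^ CARD('m) \<le> r ^ CARD('n)"
  shows "1 / 2 \<le> real r * (\<Sum>i\<in>UNIV. \<integral>x. min 1 (l1_length (K (axis i 1) x) / real L) \<partial>M)"
proof -
  interpret free_cocycle M a K by fact
  define F :: "(int ^ 'm) set" where "F = vec_cube L"
  define B :: "(int ^ 'n) set" where "B = vec_cube r"
  have F: "finite F" and B: "finite B" by (simp_all add: F_def B_def finite_vec_cube)
  have cF: "card F = L ^ CARD('m)" and cB: "card B = r ^ CARD('n)"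
    by (simp_all add: F_def B_def card_vec_cube)
  have pos: "real (card F) > 0" using L by (simp add: cF)
  have "2 * card F \<le> card B" using r by (simp add: cF cB)
  then have two: "2 * real (card F) \<le> real (card B)" by linarith
  then have posB: "real (card B) > 0" using pos by linarith
  define S where "S = (\<Sum>i\<in>UNIV. mean_displacement F (axis i 1))"
  have nonneg: "0 \<le> mean_displacement F g" for g
    unfolding mean_displacement_def by (rule integral_nonneg_AE) simp
  have "real (card F) * real (card B) / 2 \<le>
      real (card F) * real (card B) - real (card F) * real (card F)"
    using mult_left_mono[OF two, of "real (card F)"] by (simp add: algebra_simps)
  also have "\<dots> \<le> (\<Sum>b\<in>B. mean_displacement F b)"
    by (rule sum_mean_displacement_ge[OF F B])
  also have "\<dots> \<le> (\<Sum>b\<in>B. real r * S)"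
  proof (rule sum_mono)
    fix b assume "b \<in> B"
    then have b: "0 \<le> b $ i" "b $ i \<le> int r" for i
      by (auto simp: B_def vec_cube_def vec_box_def less_imp_le)
    have "mean_displacement F b \<le> (\<Sum>i\<in>UNIV. real_of_int (b $ i) * mean_displacement F (axis i 1))"
      by (rule subadditive_vec_le)
         (auto simp: mean_displacement_zero[OF F] mean_displacement_add[OF F] b)
    also have "\<dots> \<le> (\<Sum>i\<in>UNIV. real r * mean_displacement F (axis i 1))"
      by (intro sum_mono mult_right_mono nonneg) (use b in \<open>simp add: of_int_le_iff[of _ "int r", simplified]\<close>)
    finally show "mean_displacement F b \<le> real r * S" by (simp add: S_def sum_distrib_left)
  qed
  also have "\<dots> = real (card B) * (real r * S)" by simp
  finally have "real (card F) / 2 \<le> real r * S"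
    using posB by (simp add: field_simps)
  also have "S \<le> real (card F) * (\<Sum>i\<in>UNIV. \<integral>x. min 1 (l1_length (K (axis i 1) x) / real L) \<partial>M)"
    unfolding S_def sum_distrib_left
  proof (rule sum_mono)
    fix i
    have "mean_displacement F (axis i 1) \<le>
        (\<integral>x. real (card F) * min 1 (l1_length (K (axis i 1) x) / real L) \<partial>M)"
      unfolding mean_displacement_def
    proof (rule integral_mono)
      show "integrable M (\<lambda>x. real (card F) * min 1 (l1_length (K (axis i 1) x) / real L))"
        by (intro integrable_mult_right integrable_const_bound[where B=1])
           (auto simp: l1_length_def sum_nonneg)
      show "real (displaced F (K (axis i 1) x)) \<le>
          real (card F) * min 1 (l1_length (K (axis i 1) x) / real L)" for x
        using displaced_cube_le[OF L] by (simp add: card_vec_cube F_def)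
    qed (rule integrable_displaced[OF F])
    then show "mean_displacement F (axis i 1) \<le>
        real (card F) * (\<integral>x. min 1 (l1_length (K (axis i 1) x) / real L) \<partial>M)" by simp
  qed
  finally have "real (card F) / 2 \<le> real r * (real (card F) *
      (\<Sum>i\<in>UNIV. \<integral>x. min 1 (l1_length (K (axis i 1) x) / real L) \<partial>M))"
    by (simp add: mult_left_mono)
  then show ?thesis using pos by (simp add: field_simps)
qed

section \<open>Dyadic sums of the functions $\varpi^{(k)}_\alpha$\<close>

lemma iter_log_0 [simp]: "iter_log 0 t = t"
  by (simp add: iter_log_def)

lemma iter_log_Suc: "iter_log (Suc j) t = ln (iter_log j t)"
  by (simp add: iter_log_def)

lemma Lambda_log_0 [simp]: "Lambda_log 0 t = 1"
  by (simp add: Lambda_log_def)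

lemma Lambda_log_Suc: "Lambda_log (Suc k) t = Lambda_log k t * iter_log (Suc k) t"
  by (simp add: Lambda_log_def)

lemma filterlim_iter_log_at_top: "filterlim (iter_log j) at_top at_top"
proof (induction j)
  case 0
  then show ?case by (simp add: iter_log_def filterlim_ident)
next
  case (Suc j)
  show ?case
    unfolding iter_log_Suc[abs_def] by (rule filterlim_compose[OF ln_at_top Suc])
qed

text \<open>Slow variation in the weak form needed here. The factor by which doubling multiplies \<open>f\<close>
  becomes a bounded summand after taking logarithms, and \<open>ln \<circ> f\<close> tends to infinity.\<close>
lemma tendsto_ln_ratio:
  fixes f :: "real \<Rightarrow> real"
  assumes f: "filterlim f at_top at_top"
    and lim: "((\<lambda>t. f (2 * t) / f t) \<longlongrightarrow> c) at_top" and c: "c > 0"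
  shows "((\<lambda>t. ln (f (2 * t)) / ln (f t)) \<longlongrightarrow> 1) at_top"
proof -
  have "((\<lambda>t. ln (f (2 * t) / f t)) \<longlongrightarrow> ln c) at_top"
    using lim c by (intro tendsto_ln) auto
  moreover have "filterlim (\<lambda>t. ln (f t)) at_top at_top"
    by (rule filterlim_compose[OF ln_at_top f])
  ultimately have "((\<lambda>t. 1 + ln (f (2 * t) / f t) / ln (f t)) \<longlongrightarrow> 1 + 0) at_top"
    by (intro tendsto_add tendsto_const tendsto_divide_0) (auto intro: filterlim_at_top_imp_at_infinity)
  moreover have "\<forall>\<^sub>F t in at_top. 1 + ln (f (2 * t) / f t) / ln (f t) = ln (f (2 * t)) / ln (f t)"
  proof -
    have "filterlim (\<lambda>t::real. 2 * t) at_top at_top"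
      by (rule filterlim_tendsto_pos_mult_at_top[OF tendsto_const _ filterlim_ident]) simp
    from filterlim_compose[OF f this] have "\<forall>\<^sub>F t in at_top. f (2 * t) > 0"
      by (simp add: filterlim_at_top_dense)
    moreover have "\<forall>\<^sub>F t in at_top. f t > 1"
      using f by (simp add: filterlim_at_top_dense)
    ultimately show ?thesis
    proof eventually_elim
      case (elim t)
      then show ?case by (simp add: ln_div field_simps)
    qed
  qed
  ultimately show ?thesis by (simp add: tendsto_cong)
qed

lemma tendsto_iter_log_ratio:
  "((\<lambda>t. iter_log (Suc j) (2 * t) / iter_log (Suc j) t) \<longlongrightarrow> 1) at_top"
proof (induction j)
  case 0
  have "\<forall>\<^sub>F t::real in at_top. 2 = 2 * t / t"
    using eventually_gt_at_top[of 0] by eventually_elim auto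
  then have "((\<lambda>t::real. 2 * t / t) \<longlongrightarrow> 2) at_top"
    by (rule tendsto_eventually[OF eventually_mono]) simp
  from tendsto_ln_ratio[OF filterlim_ident this] show ?case
    by (simp add: iter_log_Suc)
next
  case (Suc j)
  from tendsto_ln_ratio[OF filterlim_iter_log_at_top this] show ?case
    by (simp add: iter_log_Suc)
qed

lemma tendsto_Lambda_log_ratio:
  "((\<lambda>t. Lambda_log k (2 * t) / Lambda_log k t) \<longlongrightarrow> 1) at_top"
proof (induction k)
  case (Suc k)
  from tendsto_mult[OF this tendsto_iter_log_ratio[of k]] show ?case
    by (simp add: Lambda_log_Suc)
qed simp

text \<open>The summands grow at least geometrically up to the index \<open>N\<close> and decay at least geometrically
  from there on, so the sum is comparable to its largest summand. Both halves are bounded by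
  telescoping.\<close>
lemma dyadic_weight_sum_le:
  fixes w :: "nat \<Rightarrow> real"
  assumes pos: "\<And>j. w j > 0" and q: "q > 1" and p: "p < 1"
    and lower: "\<And>j. q * w j \<le> w (Suc j)" and upper: "\<And>j. w (Suc j) \<le> 2 * p * w j"
  shows "(\<Sum>j<J. w j * min 1 (2 ^ N / 2 ^ j)) \<le> (1 / (q - 1) + 1 / (1 - p)) * w N"
proof -
  have below: "(\<Sum>j<N. w j) \<le> w N / (q - 1)"
  proof -
    have "(q - 1) * (\<Sum>j<N. w j) \<le> (\<Sum>j<N. w (Suc j) - w j)"
      unfolding sum_distrib_left
      by (intro sum_mono) (use lower in \<open>simp add: algebra_simps\<close>)
    also have "\<dots> \<le> w N" using pos[of 0] by (simp add: sum_lessThan_telescope)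
    finally show ?thesis using q by (simp add: field_simps)
  qed
  have above: "(\<Sum>i<J. w (N + i) / 2 ^ i) \<le> w N / (1 - p)"
  proof -
    have "(1 - p) * (\<Sum>i<J. w (N + i) / 2 ^ i) \<le>
        (\<Sum>i<J. w (N + i) / 2 ^ i - w (N + Suc i) / 2 ^ Suc i)"
      unfolding sum_distrib_left
    proof (rule sum_mono)
      fix i
      show "(1 - p) * (w (N + i) / 2 ^ i) \<le> w (N + i) / 2 ^ i - w (N + Suc i) / 2 ^ Suc i"
        using upper[of "N + i"] by (simp add: field_simps)
    qed
    also have "\<dots> = w N - w (N + J) / 2 ^ J"
      by (subst sum_lessThan_telescope') simp
    also have "\<dots> \<le> w N" using pos[of "N + J"] by simp
    finally show ?thesis using p by (simp add: field_simps)
  qed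
  have "(\<Sum>j<J. w j * min 1 (2 ^ N / 2 ^ j)) \<le> (\<Sum>j<N + J. w j * min 1 (2 ^ N / 2 ^ j))"
    by (rule sum_mono2) (use pos in \<open>auto simp: less_imp_le\<close>)
  also have "\<dots> = (\<Sum>j<N. w j * min 1 (2 ^ N / 2 ^ j)) + (\<Sum>i<J. w (N + i) * min 1 (2 ^ N / 2 ^ (N + i)))"
    by (induction J) auto
  also have "\<dots> \<le> (\<Sum>j<N. w j) + (\<Sum>i<J. w (N + i) / 2 ^ i)"
  proof (intro add_mono sum_mono)
    show "w j * min 1 (2 ^ N / 2 ^ j) \<le> w j" for j
      using pos[of j] by (simp add: mult_left_le less_imp_le)
    show "w (N + i) * min 1 (2 ^ N / 2 ^ (N + i)) \<le> w (N + i) / 2 ^ i" for i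
      using mult_left_mono[OF min.cobounded2, of "w (N + i)" 1 "2 ^ N / 2 ^ (N + i)"] pos[of "N + i"]
      by (simp add: power_add less_imp_le)
  qed
  also have "\<dots> \<le> w N / (q - 1) + w N / (1 - p)"
    by (intro add_mono below above)
  finally show ?thesis by (simp add: algebra_simps)
qed

context
  fixes \<alpha> T :: real and k :: nat
  assumes adm: "admissible_threshold \<alpha> k T"
begin

lemma threshold_pos: "T > 0"
  using adm by (simp add: admissible_threshold_def)

lemma iter_log_pos: "T \<le> t \<Longrightarrow> j \<le> k \<Longrightarrow> iter_log j t > 0"
  using adm by (cases j) (auto simp: admissible_threshold_def)

lemma iter_log_mono: "T \<le> s \<Longrightarrow> s \<le> t \<Longrightarrow> j \<le> k \<Longrightarrow> iter_log j s \<le> iter_log j t"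
proof (induction j)
  case (Suc j)
  then show ?case using iter_log_pos[of s j] by (simp add: iter_log_Suc)
qed simp

lemma Lambda_log_pos: "T \<le> t \<Longrightarrow> Lambda_log k t > 0"
  unfolding Lambda_log_def by (intro prod_pos) (auto intro: iter_log_pos)

lemma Lambda_log_mono: "T \<le> s \<Longrightarrow> s \<le> t \<Longrightarrow> Lambda_log k s \<le> Lambda_log k t"
  unfolding Lambda_log_def by (intro prod_mono) (auto intro: iter_log_mono less_imp_le iter_log_pos)

text \<open>The reciprocal of $t \Lambda_k(t)$ has the primitive $\log^{(k+1)}$, which is unbounded. This is
  why $\Lambda_k$ is the borderline for divergence in the next two lemmas.\<close>
lemma has_derivative_iter_log:
  assumes "T \<le> t" "j \<le> k"
  shows "(iter_log (Suc j) has_real_derivative 1 / (t * Lambda_log j t)) (at t)"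
  using assms(2)
proof (induction j)
  case 0
  show ?case
    using DERIV_ln_divide[of t] assms(1) threshold_pos by (simp add: iter_log_Suc[abs_def])
next
  case (Suc j)
  then have "iter_log (Suc j) t > 0" by (intro iter_log_pos assms)
  then show ?case
    using Suc unfolding iter_log_Suc[abs_def, of "Suc j"]
    by (auto intro!: derivative_eq_intros simp: Lambda_log_Suc)
qed

lemma iter_log_doubling_le:
  assumes "T \<le> s"
  shows "iter_log (Suc k) (2 * s) - iter_log (Suc k) s \<le> 1 / Lambda_log k s"
proof -
  have s: "s > 0" using assms threshold_pos by simp
  have "\<exists>z>s. z < 2 * s \<and> iter_log (Suc k) (2 * s) - iter_log (Suc k) s =
      (2 * s - s) * (1 / (z * Lambda_log k z))"
    using assms s by (intro MVT2 has_derivative_iter_log) auto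
  then obtain z where z: "z > s"
    "iter_log (Suc k) (2 * s) - iter_log (Suc k) s = s / (z * Lambda_log k z)" by auto
  have "s * Lambda_log k s \<le> z * Lambda_log k z"
    using z s assms Lambda_log_mono[of s z] Lambda_log_pos[of s] by (intro mult_mono) auto
  then have "s / (z * Lambda_log k z) \<le> s / (s * Lambda_log k s)"
    using s assms z(1) Lambda_log_pos[of s] Lambda_log_pos[of z] by (intro divide_left_mono) auto
  also have "\<dots> = 1 / Lambda_log k s" using s by simp
  finally show ?thesis using z by simp
qed

lemma sum_inverse_Lambda_log_unbounded:
  assumes "T \<le> 2 ^ j0"
  shows "\<exists>J. (\<Sum>j<J. 1 / Lambda_log k (2 ^ (j0 + j))) > R"
proof -
  let ?l = "\<lambda>j. iter_log (Suc k) (2 ^ (j0 + j))"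
  have "\<forall>\<^sub>F t in at_top. iter_log (Suc k) t > R + ?l 0"
    using filterlim_iter_log_at_top by (simp add: filterlim_at_top_dense)
  then obtain t0 where t0: "\<And>t. t \<ge> t0 \<Longrightarrow> iter_log (Suc k) t > R + ?l 0"
    by (auto simp: eventually_at_top_linorder)
  obtain J where "t0 < 2 ^ J" using real_arch_pow[of 2 t0] by auto
  also have "(2::real) ^ J \<le> 2 ^ (j0 + J)" by (rule power_increasing) auto
  finally have J: "?l J > R + ?l 0" by (intro t0) simp
  have "?l J - ?l 0 = (\<Sum>j<J. ?l (Suc j) - ?l j)"
    by (rule sum_lessThan_telescope[of ?l J, symmetric])
  also have "\<dots> \<le> (\<Sum>j<J. 1 / Lambda_log k (2 ^ (j0 + j)))"
  proof (rule sum_mono)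
    fix j
    have "T \<le> 2 ^ (j0 + j)"
      using assms by (rule order_trans) (simp add: power_increasing)
    then show "?l (Suc j) - ?l j \<le> 1 / Lambda_log k (2 ^ (j0 + j))"
      using iter_log_doubling_le[of "2 ^ (j0 + j)"] by simp
  qed
  finally show ?thesis using J by (intro exI[of _ J]) simp
qed

lemma varpi_threshold_pos: "varpi \<alpha> k T T > 0"
  using threshold_pos Lambda_log_pos[of T] by (simp add: varpi_def)

lemma varpi_mono: "s \<le> t \<Longrightarrow> varpi \<alpha> k T s \<le> varpi \<alpha> k T t"
  using adm by (auto simp: varpi_def admissible_threshold_def mono_on_def)

lemma varpi_ge_threshold: "varpi \<alpha> k T T \<le> varpi \<alpha> k T t"
  using varpi_mono[of T t] by (cases "t \<ge> T") (auto simp: varpi_def)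

text \<open>At large dyadic arguments \<open>varpi \<alpha> k T\<close> is multiplied in each step by a factor between
  $2^{\alpha/2}$, since $\Lambda_k$ varies slowly, and $2^\alpha$, since $\Lambda_k$ increases. As
  \<open>0 < \<alpha> < 1\<close>, these factors lie strictly between 1 and 2, as the bound for dyadic weights requires.
  The sum is a discrete form of $\int \varpi(s) \min(1, u/s)\, ds/s$.\<close>
lemma varpi_dyadic_sum_le:
  assumes \<alpha>: "0 < \<alpha>" "\<alpha> < 1"
  obtains j0 C where "T \<le> 2 ^ j0" "C > 0"
    "\<And>u J. u \<ge> 0 \<Longrightarrow>
       (\<Sum>j<J. varpi \<alpha> k T (2 ^ (j0 + j)) * min 1 (u / 2 ^ (j0 + j))) \<le> C * varpi \<alpha> k T u"
proof -
  let ?\<phi> = "varpi \<alpha> k T"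
  define q where "q = 2 powr (\<alpha> / 2)"
  define p where "p = 2 powr (\<alpha> - 1)"
  have q: "q > 1" and p: "p < 1" using \<alpha> by (simp_all add: q_def p_def powr_less_one)
  have "\<forall>\<^sub>F t in at_top. Lambda_log k (2 * t) / Lambda_log k t < q"
    by (rule order_tendstoD(2)[OF tendsto_Lambda_log_ratio q])
  then obtain S where S: "\<And>t. t \<ge> S \<Longrightarrow> Lambda_log k (2 * t) / Lambda_log k t < q"
    by (auto simp: eventually_at_top_linorder)
  obtain j0 where j0: "max S T < 2 ^ j0" using real_arch_pow[of 2 "max S T"] by auto
  define w where "w j = ?\<phi> (2 ^ (j0 + j))" for j
  have ge: "(2::real) ^ (j0 + j) \<ge> max S T" for j
    using j0 power_increasing[of j0 "j0 + j" "2::real"] by linarith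
  have w: "w j = (2 ^ (j0 + j)) powr \<alpha> / Lambda_log k (2 ^ (j0 + j))" for j
    using ge[of j] by (simp add: w_def varpi_def)
  have w_pos: "w j > 0" for j
    using varpi_ge_threshold varpi_threshold_pos unfolding w_def by (rule less_le_trans[rotated])
  have lower: "q * w j \<le> w (Suc j)" for j
  proof -
    define s :: real where "s = 2 ^ (j0 + j)"
    have s: "s > 0" "s \<ge> S" "s \<ge> T" "w j = s powr \<alpha> / Lambda_log k s"
      "w (Suc j) = (2 * s) powr \<alpha> / Lambda_log k (2 * s)"
      using ge[of j] w[of j] w[of "Suc j"] by (simp_all add: s_def)
    have L: "Lambda_log k s > 0" "Lambda_log k (2 * s) > 0" using s by (auto intro!: Lambda_log_pos)
    have "Lambda_log k (2 * s) \<le> q * Lambda_log k s"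
      using S[of s] s L by (simp add: field_simps)
    moreover have "(2 * s) powr \<alpha> = q * q * s powr \<alpha>"
      using s by (simp add: q_def powr_mult flip: powr_add)
    moreover have "q * w j = q * q * s powr \<alpha> / (q * Lambda_log k s)"
      using q s by simp
    moreover have "q * q * s powr \<alpha> / (q * Lambda_log k s) \<le> q * q * s powr \<alpha> / Lambda_log k (2 * s)"
      using calculation(1) L q by (intro divide_left_mono) auto
    ultimately show ?thesis using s by simp
  qed
  have upper: "w (Suc j) \<le> 2 * p * w j" for j
  proof -
    define s :: real where "s = 2 ^ (j0 + j)"
    have s: "s > 0" "s \<ge> T" "w j = s powr \<alpha> / Lambda_log k s"
      "w (Suc j) = (2 * s) powr \<alpha> / Lambda_log k (2 * s)"
      using ge[of j] w[of j] w[of "Suc j"] by (simp_all add: s_def)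
    have "Lambda_log k s > 0" "Lambda_log k s \<le> Lambda_log k (2 * s)"
      using s by (auto intro!: Lambda_log_pos Lambda_log_mono)
    then have "w (Suc j) \<le> (2 * s) powr \<alpha> / Lambda_log k s"
      unfolding s(4) by (intro divide_left_mono) auto
    also have "(2 * s) powr \<alpha> = 2 * p * s powr \<alpha>"
      using s by (simp add: p_def powr_mult powr_diff)
    finally show ?thesis by (simp add: s)
  qed
  define C0 where "C0 = 1 / (q - 1) + 1 / (1 - p)"
  have C0: "C0 > 0" using q p by (simp add: C0_def add_pos_pos)
  have sum_w: "(\<Sum>j<J. w j * min 1 (2 ^ N / 2 ^ j)) \<le> C0 * w N" for J N
    unfolding C0_def by (rule dyadic_weight_sum_le[of w q p, OF w_pos q p lower upper])
  define C where "C = 2 * C0 + C0 * w 0 / ?\<phi> T"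
  show ?thesis
  proof (rule that[of j0 C])
    show "T \<le> 2 ^ j0" using j0 by simp
    show "C > 0" using C0 w_pos[of 0] varpi_threshold_pos by (simp add: C_def add_pos_pos)
    fix u :: real and J assume u: "u \<ge> 0"
    have \<phi>u: "0 < ?\<phi> T" "?\<phi> T \<le> ?\<phi> u" using varpi_threshold_pos varpi_ge_threshold by auto
    show "(\<Sum>j<J. ?\<phi> (2 ^ (j0 + j)) * min 1 (u / 2 ^ (j0 + j))) \<le> C * ?\<phi> u"
    proof (cases "u < 2 ^ j0")
      case True
      \<comment> \<open>The positive lower bound of \<open>varpi\<close> absorbs the sum at the first admissible scale.\<close>
      have "(\<Sum>j<J. ?\<phi> (2 ^ (j0 + j)) * min 1 (u / 2 ^ (j0 + j))) \<le> (\<Sum>j<J. w j * min 1 (2 ^ 0 / 2 ^ j))"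
        unfolding w_def[symmetric]
      proof (intro sum_mono mult_left_mono less_imp_le[OF w_pos] min.mono order_refl)
        show "u / 2 ^ (j0 + j) \<le> 2 ^ 0 / 2 ^ j" for j
          using True by (simp add: power_add field_simps)
      qed
      also have "\<dots> \<le> C0 * w 0" by (rule sum_w)
      also have "\<dots> = C0 * w 0 / ?\<phi> T * ?\<phi> T" using \<phi>u by simp
      also have "\<dots> \<le> C * ?\<phi> u"
        using \<phi>u C0 w_pos[of 0] by (intro mult_mono) (simp_all add: C_def)
      finally show ?thesis .
    next
      case False
      define n where "n = (LEAST n. u < 2 ^ (j0 + n))"
      have "\<exists>n. u < 2 ^ (j0 + n)"
      proof -
        obtain n where "u < 2 ^ n" using real_arch_pow[of 2 u] by auto
        also have "(2::real) ^ n \<le> 2 ^ (j0 + n)" by (rule power_increasing) auto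
        finally show ?thesis ..
      qed
      then have n: "u < 2 ^ (j0 + n)" unfolding n_def by (rule LeastI_ex)
      with False obtain N where N: "n = Suc N" by (cases n) auto
      have "\<not> u < 2 ^ (j0 + N)"
        using not_less_Least[of N "\<lambda>n. u < 2 ^ (j0 + n)"] N by (simp add: n_def)
      then have wN: "w N \<le> ?\<phi> u" unfolding w_def by (intro varpi_mono) simp
      have "(\<Sum>j<J. ?\<phi> (2 ^ (j0 + j)) * min 1 (u / 2 ^ (j0 + j))) \<le>
          (\<Sum>j<J. 2 * (w j * min 1 (2 ^ N / 2 ^ j)))"
        unfolding w_def[symmetric] mult.left_commute[of 2]
      proof (intro sum_mono mult_left_mono less_imp_le[OF w_pos])
        fix j
        have "u / 2 ^ (j0 + j) \<le> 2 * (2 ^ N / 2 ^ j)"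
          using n by (simp add: N power_add field_simps)
        then show "min 1 (u / 2 ^ (j0 + j)) \<le> 2 * min 1 (2 ^ N / 2 ^ j)" by linarith
      qed
      also have "\<dots> \<le> 2 * (C0 * w N)"
        using sum_w[of N J] by (simp flip: sum_distrib_left)
      also have "\<dots> \<le> 2 * (C0 * ?\<phi> u)" using wN C0 by simp
      also have "\<dots> \<le> C * ?\<phi> u"
        using C0 w_pos[of 0] \<phi>u by (simp add: C_def algebra_simps)
      finally show ?thesis .
    qed
  qed
qed

end

section \<open>The cocycle of an orbit equivalence\<close>

text \<open>A countable base of a Hausdorff topology separates points, so equality of two maps is a
  countable conjunction of measurable conditions.\<close>
lemma standard_prob_space_sets_Collect_eq:
  assumes N: "standard_prob_space N" and f: "f \<in> measurable M N" and g: "g \<in> measurable M N"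
  shows "{x\<in>space M. f x = g x} \<in> sets M"
proof -
  obtain T where T: "topspace T = space N" "completely_metrizable_space T" "second_countable T"
    "sets N = sigma_sets (space N) {U. openin T U}"
    using N by (auto simp: standard_prob_space_def)
  obtain \<B> where "countable \<B> \<and> (\<forall>V\<in>\<B>. openin T V) \<and>
      (\<forall>U x. openin T U \<and> x \<in> U \<longrightarrow> (\<exists>V\<in>\<B>. x \<in> V \<and> V \<subseteq> U))"
    using T(3) unfolding second_countable_def by (rule exE)
  then have \<B>: "countable \<B>" "\<And>V. V \<in> \<B> \<Longrightarrow> openin T V"
    "\<And>U x. openin T U \<Longrightarrow> x \<in> U \<Longrightarrow> \<exists>V\<in>\<B>. x \<in> V \<and> V \<subseteq> U"
    by simp_all
  have hd: "Hausdorff_space T"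
    using T(2) by (intro metrizable_imp_Hausdorff_space completely_metrizable_imp_metrizable_space)
  have sep: "\<exists>V\<in>\<B>. y \<in> V \<and> z \<notin> V" if yz: "y \<in> space N" "z \<in> space N" "y \<noteq> z" for y z
  proof -
    obtain U V where "openin T U" "y \<in> U" "z \<in> V" "disjnt U V"
      using hd yz unfolding Hausdorff_space_def T(1) by meson
    then show ?thesis using \<B>(3)[of U y] by (auto simp: disjnt_def)
  qed
  have sets: "V \<in> sets N" if "V \<in> \<B>" for V
    using \<B>(2)[OF that] unfolding T(4) by (auto intro: sigma_sets.Basic)
  have "{x\<in>space M. f x = g x} = {x\<in>space M. \<forall>V\<in>\<B>. f x \<in> V \<longleftrightarrow> g x \<in> V}"
  proof (intro Collect_cong conj_cong refl)
    fix x assume "x \<in> space M"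
    then show "f x = g x \<longleftrightarrow> (\<forall>V\<in>\<B>. f x \<in> V \<longleftrightarrow> g x \<in> V)"
      using sep[of "f x" "g x"] measurable_space[OF f] measurable_space[OF g] by auto
  qed
  also have "\<dots> \<in> sets M"
  proof (rule sets.sets_Collect_countable_All'[OF _ \<B>(1)])
    fix V assume "V \<in> \<B>"
    note [measurable] = f g sets[OF this]
    show "{x\<in>space M. f x \<in> V \<longleftrightarrow> g x \<in> V} \<in> sets M" by measurable
  qed
  finally show ?thesis .
qed

text \<open>The cocycle is redefined to be \<open>0\<close> on a null set, off which the defining properties of the
  orbit equivalence hold along the whole orbit of a point. Measurability needs an argument: the
  nonnegative integral is a supremum over simple functions below the integrand, so for a
  non-measurable integrand its finiteness would not give integrability. It holds because the sets
  on which the cocycle is constant are given by an equality of two measurable maps into a standard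
  space.\<close>
lemma free_orbit_equivalence_cocycle:
  fixes a :: "'g::group_add \<Rightarrow> 'x \<Rightarrow> 'x" and b :: "'h::group_add \<Rightarrow> 'y \<Rightarrow> 'y"
  assumes a: "free_pmp_action M a" and b: "free_pmp_action N b"
    and oe: "orbit_equivalence M a N b \<Phi>"
  obtains K where "free_cocycle M a K" "\<And>g. AE x in M. K g x = oe_cocycle a b \<Phi> g x"
proof -
  have cg: "countable (UNIV :: 'g set)" and a0: "\<And>x. x \<in> space M \<Longrightarrow> a 0 x = x"
    and a_add: "\<And>g h x. x \<in> space M \<Longrightarrow> a (g + h) x = a g (a h x)"
    and a_meas [measurable]: "\<And>g. a g \<in> measurable M M" and a_distr: "\<And>g. distr M M (a g) = M"
    and a_free: "AE x in M. \<forall>g. g \<noteq> 0 \<longrightarrow> a g x \<noteq> x" and M: "prob_space M"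
    using a by (auto simp: free_pmp_action_def pmp_action_def standard_prob_space_def)
  have ch: "countable (UNIV :: 'h set)" and b0: "\<And>y. y \<in> space N \<Longrightarrow> b 0 y = y"
    and b_add: "\<And>g h y. y \<in> space N \<Longrightarrow> b (g + h) y = b g (b h y)"
    and b_meas [measurable]: "\<And>h. b h \<in> measurable N N"
    and b_free: "AE y in N. \<forall>h. h \<noteq> 0 \<longrightarrow> b h y \<noteq> y" and stN: "standard_prob_space N"
    using b by (auto simp: free_pmp_action_def pmp_action_def)
  obtain X Y where X [measurable]: "X \<in> sets M" and Y: "Y \<in> sets N" and AE_X: "AE x in M. x \<in> X"
    and bij: "bij_betw \<Phi> X Y"
    and meas: "\<Phi> \<in> measurable (restrict_space M X) (restrict_space N Y)"
    and distr: "distr (restrict_space M X) (restrict_space N Y) \<Phi> = restrict_space N Y"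
    using oe by (auto simp: orbit_equivalence_def measure_iso_def)
  have "AE y in restrict_space N Y. \<forall>h. h \<noteq> 0 \<longrightarrow> b h y \<noteq> y"
    using b_free Y by (subst AE_restrict_space_iff) auto
  then have "AE x in restrict_space M X. \<forall>h. h \<noteq> 0 \<longrightarrow> b h (\<Phi> x) \<noteq> \<Phi> x"
    by (intro AE_distrD[OF meas]) (unfold distr)
  then have b_free': "AE x in M. x \<in> X \<longrightarrow> (\<forall>h. h \<noteq> 0 \<longrightarrow> b h (\<Phi> x) \<noteq> \<Phi> x)"
    using X by (subst (asm) AE_restrict_space_iff) auto
  \<comment> \<open>\<open>P\<close> collects the almost sure properties of a single point; \<open>G\<close> consists of points all of whose
    translates satisfy \<open>P\<close>.\<close>
  define P where "P x \<longleftrightarrow> x \<in> X \<and> (\<forall>g. g \<noteq> 0 \<longrightarrow> a g x \<noteq> x) \<and>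
    (\<forall>h. h \<noteq> 0 \<longrightarrow> b h (\<Phi> x) \<noteq> \<Phi> x) \<and> \<Phi> ` range (\<lambda>g. a g x) = range (\<lambda>h. b h (\<Phi> x))" for x
  have "AE x in M. \<Phi> ` range (\<lambda>g. a g x) = range (\<lambda>h. b h (\<Phi> x))"
    using oe by (simp add: orbit_equivalence_def)
  with AE_X a_free b_free' have "AE x in M. P x"
    unfolding P_def by eventually_elim blast
  then have "AE x in M. P (a g x)" for g
    by (intro AE_distrD[OF a_meas]) (unfold a_distr)
  then have "AE x in M. \<forall>g\<in>UNIV. P (a g x)"
    by (subst AE_ball_countable[OF cg]) simp
  then obtain Z where Z: "{x\<in>space M. \<not> (\<forall>g\<in>UNIV. P (a g x))} \<subseteq> Z" "Z \<in> null_sets M"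
    by (auto elim!: AE_E3)
  define G where "G = space M - Z"
  have G [measurable]: "G \<in> sets M" using Z(2) by (auto simp: G_def)
  have G_space: "x \<in> space M" if "x \<in> G" for x using that by (simp add: G_def)
  have G_P: "P (a g x)" if "x \<in> G" for x g using that Z(1) by (auto simp: G_def)
  have G_X: "a g x \<in> X" if "x \<in> G" for x g using G_P[OF that] by (simp add: P_def)
  have G_P0: "P x" if "x \<in> G" for x using G_P[OF that, of 0] a0[OF G_space[OF that]] by simp
  have G_in_X: "x \<in> X" if "x \<in> G" for x using G_P0[OF that] by (simp add: P_def)
  have AE_G: "AE x in M. x \<in> G"
    using AE_not_in[OF Z(2)] by (rule AE_mp) (auto simp: G_def)
  have AE_aG: "AE x in M. a h x \<in> G" for h
    by (rule AE_distrD[OF a_meas]) (unfold a_distr, rule AE_G)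
  have \<Phi>_space: "\<Phi> x \<in> space N" if "x \<in> X" for x
    using bij that sets.sets_into_space[OF Y] by (auto simp: bij_betw_def)
  have unique: "h = h'" if x: "x \<in> G" and eq: "b h (\<Phi> x) = b h' (\<Phi> x)" for h h' x
  proof -
    have y: "\<Phi> x \<in> space N" by (rule \<Phi>_space[OF G_in_X[OF x]])
    have "b (- h' + h) (\<Phi> x) = b (- h' + h') (\<Phi> x)"
      unfolding b_add[OF y] eq ..
    then have "b (- h' + h) (\<Phi> x) = \<Phi> x" using b0[OF y] by simp
    then have "- h' + h = 0" using G_P0[OF x] by (auto simp: P_def)
    then show "h = h'" by (metis add.inverse_inverse minus_unique)
  qed
  let ?c = "oe_cocycle a b \<Phi>"
  have spec: "\<Phi> (a g x) = b h (\<Phi> x) \<longleftrightarrow> ?c g x = h" if x: "x \<in> G" for g x h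
  proof -
    have "\<Phi> (a g x) \<in> range (\<lambda>h. b h (\<Phi> x))" using G_P0[OF x] by (auto simp: P_def)
    then have "\<exists>!h. \<Phi> (a g x) = b h (\<Phi> x)" using unique[OF x] by (metis rangeE)
    then show ?thesis
      unfolding oe_cocycle_def
      using theI'[of "\<lambda>h. \<Phi> (a g x) = b h (\<Phi> x)"] the1_equality[of "\<lambda>h. \<Phi> (a g x) = b h (\<Phi> x)" h]
      by auto
  qed
  define K where "K g x = (if x \<in> G then ?c g x else 0)" for g x
  have "free_cocycle M a K"
  proof (intro free_cocycle.intro M free_cocycle_axioms.intro)
    fix g h
    \<comment> \<open>\<open>\<Phi>\<close> is measurable only on \<open>X\<close>, so it is replaced by a constant off \<open>X\<close>.\<close>
    obtain y0 where y0: "y0 \<in> space N"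
      using stN prob_space.not_empty[of N] by (auto simp: standard_prob_space_def)
    define \<Psi> where "\<Psi> x = (if x \<in> X then \<Phi> x else y0)" for x
    have \<Psi> [measurable]: "\<Psi> \<in> measurable M N"
      unfolding \<Psi>_def using meas X y0
      by (subst measurable_If_restrict_space_iff) (auto simp: measurable_restrict_space2_iff)
    have "K g -` {h} \<inter> space M \<in> sets M" for h
    proof -
      have "(\<lambda>x. \<Psi> (a g x)) \<in> measurable M N" "(\<lambda>x. b h (\<Psi> x)) \<in> measurable M N"
        by measurable
      then have eq: "{x\<in>space M. \<Psi> (a g x) = b h (\<Psi> x)} \<in> sets M"
        by (rule standard_prob_space_sets_Collect_eq[OF stN])
      have "K g -` {h} \<inter> space M =
          (G \<inter> {x\<in>space M. \<Psi> (a g x) = b h (\<Psi> x)}) \<union> (if h = 0 then space M - G else {})"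
        using spec G_space G_X G_in_X by (auto simp: K_def \<Psi>_def split: if_splits)
      also have "\<dots> \<in> sets M"
        by (intro sets.Un sets.Int G eq) simp
      finally show ?thesis .
    qed
    then show "K g \<in> measurable M (count_space UNIV)"
      by (subst measurable_count_space_eq_countable[OF ch]) auto
    show "AE x in M. K (g + h) x = K g (a h x) + K h x"
      using AE_G AE_aG[of h]
    proof eventually_elim
      case (elim x)
      have y: "\<Phi> x \<in> space N" by (rule \<Phi>_space[OF G_in_X[OF elim(1)]])
      have "\<Phi> (a (g + h) x) = \<Phi> (a g (a h x))" by (simp add: a_add G_space elim)
      also have "\<dots> = b (?c g (a h x)) (\<Phi> (a h x))" using spec[OF elim(2)] by simp
      also have "\<Phi> (a h x) = b (?c h x) (\<Phi> x)" using spec[OF elim(1)] by simp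
      also have "b (?c g (a h x)) (b (?c h x) (\<Phi> x)) = b (?c g (a h x) + ?c h x) (\<Phi> x)"
        by (simp add: b_add y)
      finally show ?case using spec[OF elim(1)] elim by (simp add: K_def)
    qed
    show "AE x in M. inj (\<lambda>g. K g x)"
      using AE_G
    proof eventually_elim
      case (elim x)
      show ?case
      proof (rule injI)
        fix g g' assume "K g x = K g' x"
        then have "?c g x = ?c g' x" using elim by (simp add: K_def)
        then have "\<Phi> (a g x) = \<Phi> (a g' x)" using spec[OF elim] by metis
        then have eq: "a g x = a g' x"
          using bij G_X[OF elim] by (auto simp: bij_betw_def inj_on_def)
        have "a (- g' + g) x = a (- g' + g') x"
          unfolding a_add[OF G_space[OF elim]] eq ..
        then have "a (- g' + g) x = x" using a0 G_space elim by simp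
        then have "- g' + g = 0" using G_P0[OF elim] by (auto simp: P_def)
        then show "g = g'" by (metis add.inverse_inverse minus_unique)
      qed
    qed
  qed (simp_all add: a_distr)
  moreover have "AE x in M. K g x = ?c g x" for g
    using AE_G by eventually_elim (simp add: K_def)
  ultimately show thesis by (rule that)
qed

section \<open>Divergence of the integral for injective cocycles\<close>

text \<open>Writing \<open>e s\<close> for the sum of the integrals of $\min(1, u_i/s)$, where $u_i$ is the rescaled
  length of the cocycle at the \<open>i\<close>-th unit vector, the displacement bound gives
  $e(s) \ge \mathrm{const} \cdot s^{-\alpha}$ for all \<open>s \<ge> 1\<close>, hence
  $\varpi(s) e(s) \ge \mathrm{const} / \Lambda_k(s)$ for large \<open>s\<close>. Summed over
  dyadic \<open>s\<close> the right-hand side diverges, while the left-hand side is bounded by a multiple of the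
  integrals of $\varpi(u_i)$.\<close>
lemma nn_integral_varpi_cocycle_infinite:
  fixes a :: "int ^ 'n::finite \<Rightarrow> 'x \<Rightarrow> 'x" and K :: "int ^ 'n \<Rightarrow> 'x \<Rightarrow> int ^ 'm::finite"
  assumes coc: "free_cocycle M a K" and nm: "CARD('m) < CARD('n)"
    and adm: "admissible_threshold (real CARD('m) / real CARD('n)) k T"
    and c: "\<And>i. c i > 0"
    and fin: "\<And>i. (\<integral>\<^sup>+x. ennreal (varpi (real CARD('m) / real CARD('n)) k T
                 (l1_length (K (axis i 1) x) / c i)) \<partial>M) < \<infinity>"
  shows False
proof -
  interpret free_cocycle M a K by fact
  define \<alpha> where "\<alpha> = real CARD('m) / real CARD('n)"
  have \<alpha>: "0 < \<alpha>" "\<alpha> < 1" using nm by (simp_all add: \<alpha>_def)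
  let ?\<phi> = "varpi \<alpha> k T"
  note adm' = adm[folded \<alpha>_def]
  have \<phi>_pos: "?\<phi> t > 0" for t
    using varpi_ge_threshold[OF adm'] varpi_threshold_pos[OF adm'] by (rule less_le_trans[rotated])
  \<comment> \<open>A common scale for all unit vectors; enlarging \<open>c i\<close> only decreases the integrals, and
    \<open>d \<ge> 1\<close> makes rounding \<open>d * s\<close> up to an integer cost at most a factor 2.\<close>
  define d where "d = 1 + (\<Sum>i\<in>UNIV. c i)"
  have d: "d \<ge> 1" "c i \<le> d" for i
    using c member_le_sum[of i UNIV c] by (auto simp: d_def sum_nonneg less_imp_le add_increasing)
  define u where "u i x = l1_length (K (axis i 1) x) / d" for i x
  have u: "u i x \<ge> 0" for i x
    using d by (auto simp: u_def l1_length_def sum_nonneg)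
  have u_meas: "(\<lambda>x. f (u i x) :: real) \<in> borel_measurable M" for f i
    unfolding u_def by (rule borel_measurable_K)
  have int_\<phi>: "integrable M (\<lambda>x. ?\<phi> (u i x))" for i
  proof (rule integrableI_nonneg)
    have "(\<integral>\<^sup>+x. ennreal (?\<phi> (u i x)) \<partial>M) \<le>
        (\<integral>\<^sup>+x. ennreal (?\<phi> (l1_length (K (axis i 1) x) / c i)) \<partial>M)"
    proof (intro nn_integral_mono ennreal_leI varpi_mono[OF adm'])
      show "u i x \<le> l1_length (K (axis i 1) x) / c i" for x
        unfolding u_def using d c[of i] by (intro divide_left_mono) (auto simp: l1_length_def sum_nonneg)
    qed
    with fin[of i] show "(\<integral>\<^sup>+x. ennreal (?\<phi> (u i x)) \<partial>M) < \<infinity>" by (simp add: \<alpha>_def)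
  qed (use \<phi>_pos in \<open>auto intro: u_meas less_imp_le\<close>)
  obtain j0 C where j0: "T \<le> 2 ^ j0" and C: "C > 0"
    and sum_le: "\<And>u J. u \<ge> 0 \<Longrightarrow>
       (\<Sum>j<J. ?\<phi> (2 ^ (j0 + j)) * min 1 (u / 2 ^ (j0 + j))) \<le> C * ?\<phi> u"
    using varpi_dyadic_sum_le[OF adm' \<alpha>] by blast
  define e where "e s = (\<Sum>i\<in>UNIV. \<integral>x. min 1 (u i x / s) \<partial>M)" for s :: real
  have int_min: "integrable M (\<lambda>x. min 1 (u i x / s))" if "s > 0" for i s
    using u that by (intro integrable_const_bound[where B=1]) (auto intro: u_meas)
  have e_lower: "1 / (8 * (2 * d) powr \<alpha>) \<le> s powr \<alpha> * e s" if s: "s \<ge> 1" for s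
  proof -
    define L where "L = nat \<lceil>d * s\<rceil>"
    have ds: "1 \<le> d * s" using d s by (metis mult_mono' mult_1 zero_le_one)
    then have L: "d * s \<le> real L" "real L \<le> 2 * d * s" "L > 0"
      unfolding L_def by linarith+
    \<comment> \<open>The factor 2 in \<open>\<rho>\<close> yields \<open>2 ^ n \<ge> 2\<close> in the comparison of the two cubes.\<close>
    define \<rho> where "\<rho> = 2 * real L powr \<alpha>"
    define r where "r = nat \<lceil>\<rho>\<rceil>"
    have \<rho>: "\<rho> \<ge> 1" using L \<alpha> ge_one_powr_ge_zero[of "real L" \<alpha>] by (simp add: \<rho>_def)
    then have r: "\<rho> \<le> real r" "real r \<le> 2 * \<rho>" unfolding r_def by linarith+
    have "real (2 * L ^ CARD('m)) \<le> 2 ^ CARD('n) * real L ^ CARD('m)"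
      using mult_right_mono[of 2 "2 ^ CARD('n)" "real L ^ CARD('m)"]
        power_increasing[of 1 "CARD('n)" "2::real"] by (simp add: Suc_le_eq)
    also have "\<dots> = \<rho> ^ CARD('n)"
      using L by (simp add: \<rho>_def power_mult_distrib \<alpha>_def powr_power powr_realpow)
    also have "\<dots> \<le> real (r ^ CARD('n))" using r \<rho> by (simp add: power_mono)
    finally have "2 * L ^ CARD('m) \<le> r ^ CARD('n)" by (simp only: of_nat_le_iff)
    from cocycle_displacement_lower_bound[OF coc L(3) this]
    have "1 / 2 \<le> real r * (\<Sum>i\<in>UNIV. \<integral>x. min 1 (l1_length (K (axis i 1) x) / real L) \<partial>M)" .
    also have "\<dots> \<le> (4 * (2 * d) powr \<alpha> * s powr \<alpha>) * e s"
    proof (intro mult_mono)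
      have "real r \<le> 4 * real L powr \<alpha>" using r by (simp add: \<rho>_def)
      also have "\<dots> \<le> 4 * (2 * d * s) powr \<alpha>" using L \<alpha> by (simp add: powr_mono2)
      finally show "real r \<le> 4 * (2 * d) powr \<alpha> * s powr \<alpha>"
        using d s by (simp add: powr_mult)
      show "(\<Sum>i\<in>UNIV. \<integral>x. min 1 (l1_length (K (axis i 1) x) / real L) \<partial>M) \<le> e s"
        unfolding e_def
      proof (intro sum_mono integral_mono min.mono order_refl)
        show "l1_length (K (axis i 1) x) / real L \<le> u i x / s" for i x
          unfolding u_def divide_divide_eq_left
          using L ds by (intro divide_left_mono) (auto simp: l1_length_def sum_nonneg)
        show "integrable M (\<lambda>x. min 1 (l1_length (K (axis i 1) x) / real L))" for i
          by (rule integrable_const_bound[where B=1]) (auto simp: l1_length_def sum_nonneg)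
      qed (use s in \<open>auto intro: int_min\<close>)
    qed (auto intro!: sum_nonneg integral_nonneg simp: l1_length_def)
    finally show ?thesis using d by (simp add: field_simps)
  qed
  define R where "R = 8 * (2 * d) powr \<alpha> * (C * (\<Sum>i\<in>UNIV. \<integral>x. ?\<phi> (u i x) \<partial>M))"
  obtain J where J: "(\<Sum>j<J. 1 / Lambda_log k (2 ^ (j0 + j))) > R"
    using sum_inverse_Lambda_log_unbounded[OF adm' j0] by blast
  have "(\<Sum>j<J. 1 / Lambda_log k (2 ^ (j0 + j))) \<le>
      (\<Sum>j<J. 8 * (2 * d) powr \<alpha> * (?\<phi> (2 ^ (j0 + j)) * e (2 ^ (j0 + j))))"
  proof (rule sum_mono)
    fix j
    define s :: real where "s = 2 ^ (j0 + j)"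
    have s: "s \<ge> 1" "s \<ge> T"
      using order_trans[OF j0 power_increasing[of j0 "j0 + j" "2::real"]] by (simp_all add: s_def)
    have pos: "Lambda_log k s > 0" by (rule Lambda_log_pos[OF adm' s(2)])
    have "1 \<le> 8 * (2 * d) powr \<alpha> * (s powr \<alpha> * e s)"
      using e_lower[OF s(1)] d by (simp add: field_simps)
    then have "1 / Lambda_log k s \<le> 8 * (2 * d) powr \<alpha> * (s powr \<alpha> * e s) / Lambda_log k s"
      using pos by (intro divide_right_mono) auto
    also have "\<dots> = 8 * (2 * d) powr \<alpha> * (?\<phi> s * e s)"
      using s by (simp add: varpi_def)
    finally show "1 / Lambda_log k (2 ^ (j0 + j)) \<le>
        8 * (2 * d) powr \<alpha> * (?\<phi> (2 ^ (j0 + j)) * e (2 ^ (j0 + j)))" by (simp add: s_def)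
  qed
  also have "\<dots> = 8 * (2 * d) powr \<alpha> *
      (\<Sum>i\<in>UNIV. \<integral>x. (\<Sum>j<J. ?\<phi> (2 ^ (j0 + j)) * min 1 (u i x / 2 ^ (j0 + j))) \<partial>M)"
  proof -
    have "(\<integral>x. (\<Sum>j<J. ?\<phi> (2 ^ (j0 + j)) * min 1 (u i x / 2 ^ (j0 + j))) \<partial>M) =
        (\<Sum>j<J. ?\<phi> (2 ^ (j0 + j)) * (\<integral>x. min 1 (u i x / 2 ^ (j0 + j)) \<partial>M))" for i
      by (subst Bochner_Integration.integral_sum) (auto intro: int_min)
    then show ?thesis
      unfolding e_def sum_distrib_left by (simp add: sum.swap[of _ UNIV] sum_distrib_left)
  qed
  also have "\<dots> \<le> 8 * (2 * d) powr \<alpha> * (\<Sum>i\<in>UNIV. \<integral>x. C * ?\<phi> (u i x) \<partial>M)"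
  proof (intro mult_left_mono sum_mono integral_mono)
    show "integrable M (\<lambda>x. \<Sum>j<J. ?\<phi> (2 ^ (j0 + j)) * min 1 (u i x / 2 ^ (j0 + j)))" for i
      by (intro Bochner_Integration.integrable_sum integrable_mult_right int_min) simp
  qed (use d in \<open>auto intro!: sum_le u int_\<phi>\<close>)
  also have "\<dots> = R" by (simp add: R_def sum_distrib_left)
  finally show False using J by simp
qed

section \<open>Absence of critical orbit equivalences\<close>

theorem corollary1p4:
  fixes k :: nat and T :: real
  assumes "CARD('n::finite) > CARD('m::finite)"
    and "admissible_threshold (real CARD('m) / real CARD('n)) k T"
  shows "(\<forall>(M :: 'x measure) (a :: int ^ 'n \<Rightarrow> 'x \<Rightarrow> 'x) (N :: 'y measure)
             (b :: int ^ 'm \<Rightarrow> 'y \<Rightarrow> 'y) (\<Phi> :: 'x \<Rightarrow> 'y).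
            free_pmp_action M a \<longrightarrow> free_pmp_action N b \<longrightarrow> orbit_equivalence M a N b \<Phi> \<longrightarrow>
            \<not> integrable_oe (Weight (varpi (real CARD('m) / real CARD('n)) k T)) l1_length M a b \<Phi>)
       \<and> \<not> groups_orbit_equivalent TYPE('x) TYPE('y)
            (Weight (varpi (real CARD('m) / real CARD('n)) k T)) L0
            (l1_length :: int ^ 'n \<Rightarrow> real) (l1_length :: int ^ 'm \<Rightarrow> real)"
    (is "?A \<and> ?B")
proof
  let ?\<omega> = "varpi (real CARD('m) / real CARD('n)) k T"
  show ?A
  proof (intro allI impI notI)
    fix M :: "'x measure" and a :: "int ^ 'n \<Rightarrow> 'x \<Rightarrow> 'x" and N :: "'y measure"
      and b :: "int ^ 'm \<Rightarrow> 'y \<Rightarrow> 'y" and \<Phi> :: "'x \<Rightarrow> 'y"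
    assume oe: "free_pmp_action M a" "free_pmp_action N b" "orbit_equivalence M a N b \<Phi>"
    obtain K where K: "free_cocycle M a K" "\<And>g. AE x in M. K g x = oe_cocycle a b \<Phi> g x"
      using free_orbit_equivalence_cocycle[OF oe] by blast
    assume "integrable_oe (Weight ?\<omega>) l1_length M a b \<Phi>"
    then have "\<forall>i::'n. \<exists>c>0. (\<integral>\<^sup>+x. ennreal (?\<omega> (l1_length (oe_cocycle a b \<Phi> (axis i 1) x) / c)) \<partial>M) < \<infinity>"
      by simp
    then obtain c where c: "\<And>i::'n. c i > 0"
      "\<And>i. (\<integral>\<^sup>+x. ennreal (?\<omega> (l1_length (oe_cocycle a b \<Phi> (axis i 1) x) / c i)) \<partial>M) < \<infinity>"
      by metis
    have "(\<integral>\<^sup>+x. ennreal (?\<omega> (l1_length (K (axis i 1) x) / c i)) \<partial>M) =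
        (\<integral>\<^sup>+x. ennreal (?\<omega> (l1_length (oe_cocycle a b \<Phi> (axis i 1) x) / c i)) \<partial>M)" for i
      using K(2)[of "axis i 1"] by (intro nn_integral_cong_AE) (rule AE_mp, auto)
    with c show False
      by (intro nn_integral_varpi_cocycle_infinite[OF K(1) assms, where c=c]) auto
  qed
  then show ?B
    unfolding groups_orbit_equivalent_def biintegrable_oe_def by blast
qed

end
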